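(* Let $S$ be a satisfiability problem in $n\ge 7$ Boolean variables, let $N\ge n$ be an integer, and let $0\le \varepsilon\le 2^{-n-1}$. Let ALB(N) be the approximate logical boosting algorithm using an approximate cloning function $\mathrm{AC}$ of approximation degree $\varepsilon$. Then ALB(N) asserts that $S$ is satisfiable or unsatisfiable with a probability of error (the probability that its assertion about $S$ is incorrect) satisfying $$P_{err} < \max\left\{2^{-7(N-n)+34},\ (2^N-1)\varepsilon\right\}.$$
   Context: A literal is a Boolean variable or its negation; a clause is a disjunction of literals. The satisfiability problem: given clauses $c_0,\dots,c_{m-1}$ in Boolean variables $x_0,\dots,x_{n-1}$, decide whether the conjunction $S=c_0\cdots c_{m-1}$ is satisfiable. A binary random variable takes values in $\{0,1\}$; $\&$, $\|$, $\sim$ denote and, or, not applied to such variables (or to qubits, in the sense of $0/1$ measurement outcomes). An approximate cloning function $\mathrm{AC}$ of approximation degree $\varepsilon\ge0$ produces, for any binary random variable (or qubit) $X$, a binary random variable (or qubit) $\mathrm{AC}(X)$ that is independent of $X$ and satisfies $|P(X=0)-P(\mathrm{AC}(X)=0)|\le\varepsilon$. The algorithm ALB(N), with integer parameter $N\ge n$: 1. Create independent binary random variables (or qubits) $X_0,\dots,X_{n-1}$ with $P(X_i=1)=P(X_i=0)=1/2$. 2. For each clause $c_j$ with non-negated variables $x_{i_0},\dots,x_{i_a}$ and negated variables $x_{k_0},\dots,x_{k_b}$, form $C_j = X_{i_0}\|\cdots\|X_{i_a}\|(\sim X_{k_0})\|\cdots\|(\sim X_{k_b})$. 3. Form $D_0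 = C_0\,\&\cdots\&\,C_{m-1}$. 4. For $v=1,\dots,N$ form $D_v = D_{v-1}\,\|\,\mathrm{AC}(D_{v-1})$. 5. Look at $D_N$: if it is $1$, assert that the problem is satisfiable; otherwise assert that it is unsatisfiable. *)

theory Defs
  imports "HOL-Probability.Probability"
begin

datatype literal = Pos nat | Neg nat

primrec lit_var :: "literal \<Rightarrow> nat" where
  "lit_var (Pos i) = i"
| "lit_var (Neg i) = i"

type_synonym clause = "literal list"
type_synonym cnf = "clause list"

(* All variables occurring in S are among x_0, ..., x_{n-1}; not all of them need occur. *)
definition cnf_in_vars :: "nat \<Rightarrow> cnf \<Rightarrow> bool" where
  "cnf_in_vars n S \<longleftrightarrow> (\<forall>c\<in>set S. \<forall>l\<in>set c. lit_var l < n)"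

primrec lit_true :: "(nat \<Rightarrow> bool) \<Rightarrow> literal \<Rightarrow> bool" where
  "lit_true a (Pos i) \<longleftrightarrow> a i"
| "lit_true a (Neg i) \<longleftrightarrow> \<not> a i"

definition satisfiable :: "cnf \<Rightarrow> bool" where
  "satisfiable S \<longleftrightarrow> (\<exists>a. \<forall>c\<in>set S. \<exists>l\<in>set c. lit_true a l)"


(* Binary random variables are bool-valued, with True for 1 and False for 0, so that the
   operations and, or, not on them are the pointwise connectives. *)

primrec lit_rv :: "(nat \<Rightarrow> 'a \<Rightarrow> bool) \<Rightarrow> literal \<Rightarrow> 'a \<Rightarrow> bool" where
  "lit_rv X (Pos i) = X i"
| "lit_rv X (Neg i) = (\<lambda>\<omega>. \<not> X i \<omega>)"

definition clause_rv :: "(nat \<Rightarrow> 'a \<Rightarrow> bool) \<Rightarrow> clause \<Rightarrow> 'a \<Rightarrow> bool" where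
  "clause_rv X c = (\<lambda>\<omega>. \<exists>l\<in>set c. lit_rv X l \<omega>)"

definition cnf_rv :: "(nat \<Rightarrow> 'a \<Rightarrow> bool) \<Rightarrow> cnf \<Rightarrow> 'a \<Rightarrow> bool" where
  "cnf_rv X S = (\<lambda>\<omega>. \<forall>c\<in>set S. clause_rv X c \<omega>)"

(* The variable D_v of the algorithm. *)
primrec alb_D ::
  "(('a \<Rightarrow> bool) \<Rightarrow> 'a \<Rightarrow> bool) \<Rightarrow> (nat \<Rightarrow> 'a \<Rightarrow> bool) \<Rightarrow> cnf \<Rightarrow> nat \<Rightarrow> 'a \<Rightarrow> bool"
where
  "alb_D AC X S 0 = cnf_rv X S"
| "alb_D AC X S (Suc v) = (\<lambda>\<omega>. alb_D AC X S v \<omega> \<or> AC (alb_D AC X S v) \<omega>)"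

(* The answer of ALB(N) on the run \<omega>: True stands for the assertion "S is satisfiable",
   False for the assertion "S is unsatisfiable". *)
definition alb_asserts_sat ::
  "(('a \<Rightarrow> bool) \<Rightarrow> 'a \<Rightarrow> bool) \<Rightarrow> (nat \<Rightarrow> 'a \<Rightarrow> bool) \<Rightarrow> cnf \<Rightarrow> nat \<Rightarrow> 'a \<Rightarrow> bool"
where
  "alb_asserts_sat AC X S N \<omega> \<longleftrightarrow> alb_D AC X S N \<omega>"

context prob_space
begin

definition binary_rv :: "('a \<Rightarrow> bool) \<Rightarrow> bool" where
  "binary_rv X \<longleftrightarrow> random_variable (count_space UNIV) X"

definition independent_fair_bits :: "nat \<Rightarrow> (nat \<Rightarrow> 'a \<Rightarrow> bool) \<Rightarrow> bool" where
  "independent_fair_bits n X \<longleftrightarrow>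
     indep_vars (\<lambda>_. count_space UNIV) X {..<n} \<and>
     (\<forall>i<n. prob {\<omega> \<in> space M. X i \<omega>} = 1/2 \<and> prob {\<omega> \<in> space M. \<not> X i \<omega>} = 1/2)"

(* The clone lives on the same probability space M as X, so M has to be rich enough to carry
   an independent clone of each of its binary random variables; every atomless M is (and can
   carry independent fair bits as well).  AC X is only required to be independent of X
   itself, not jointly of other variables. *)
definition approx_cloning_function ::
  "real \<Rightarrow> (('a \<Rightarrow> bool) \<Rightarrow> 'a \<Rightarrow> bool) \<Rightarrow> bool" where
  "approx_cloning_function \<epsilon> AC \<longleftrightarrow>
     (\<forall>X. binary_rv X \<longrightarrow>
        binary_rv (AC X) \<and>
        indep_var (count_space UNIV) X (count_space UNIV) (AC X) \<and>
        \<bar>prob {\<omega> \<in> space M. \<not> X \<omega>} - prob {\<omega> \<in> space M. \<not> AC X \<omega>}\<bar> \<le> \<epsilon>)"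

definition alb_error_prob ::
  "(('a \<Rightarrow> bool) \<Rightarrow> 'a \<Rightarrow> bool) \<Rightarrow> (nat \<Rightarrow> 'a \<Rightarrow> bool) \<Rightarrow> cnf \<Rightarrow> nat \<Rightarrow> real" where
  "alb_error_prob AC X S N =
     prob {\<omega> \<in> space M. alb_asserts_sat AC X S N \<omega> \<noteq> satisfiable S}"

end

end

theory Submission
  imports Defs
begin

text \<open>
  Write \<open>q v\<close> for the probability of \<open>D\<^sub>v = 0\<close>. Independence of the clone gives
  \<open>q (v + 1) = q v * r\<close> with \<open>\<bar>q v - r\<bar> \<le> \<epsilon>\<close>. If \<open>S\<close> is unsatisfiable then \<open>q 0 = 1\<close>, and
  \<open>1 - q v\<close> at most doubles and grows by \<open>\<epsilon>\<close> in each step. If \<open>S\<close> is satisfiable then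
  \<open>1 - q 0 \<ge> 1 / 2 ^ n\<close>, and \<open>d = 1 - q - \<epsilon>\<close> satisfies \<open>d' \<ge> d * (2 - \<epsilon> - d)\<close>, so that \<open>1 / d\<close> is
  nearly halved in each step and falls to about \<open>3\<close> after \<open>n\<close> steps. Four further steps bring
  \<open>q\<close> below \<open>1 / 2 ^ 8\<close>, from where on every step gains a factor \<open>q + \<epsilon> \<le> 1 / 2 ^ 7\<close>.
\<close>

section \<open>Two real recurrences\<close>

text \<open>Dropping the quadratic term gives the weak bound. Strictness comes from that term in the
  last step, or, if \<open>p (N - 1) = 0\<close>, from \<open>p N \<le> \<epsilon>\<close>; in the
  latter case \<open>2 \<le> N\<close> matters, since \<open>2 ^ 1 - 1 = 1\<close>.\<close>

lemma doubling_recurrence_strict_bound: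
  fixes p :: "nat \<Rightarrow> real"
  assumes p0: "p 0 = 0" and nonneg: "\<And>v. 0 \<le> p v" and \<epsilon>: "0 < \<epsilon>"
    and step: "\<And>v. p (Suc v) \<le> 2 * p v + \<epsilon> - p v * (p v + \<epsilon>)"
    and N: "2 \<le> N"
  shows "p N < (2 ^ N - 1) * \<epsilon>"
proof -
  have weak: "p v \<le> (2 ^ v - 1) * \<epsilon>" for v
  proof (induction v)
    case 0
    show ?case using p0 by simp
  next
    case (Suc v)
    have "0 \<le> p v * (p v + \<epsilon>)" using nonneg[of v] \<epsilon> by simp
    with step[of v] Suc show ?case by (simp add: algebra_simps)
  qed
  obtain v where v: "N = Suc v" "0 < v" using N by (cases N) auto
  show ?thesis
  proof (cases "p v = 0")
    case True
    have "2 * 1 < (2::real) ^ N" using power_strict_increasing[of 1 N "2::real"] N by simp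
    hence "1 * \<epsilon> < (2 ^ N - 1) * \<epsilon>" using \<epsilon> by (intro mult_strict_right_mono) auto
    thus ?thesis using step[of v] True v by simp
  next
    case False
    hence "0 < p v * (p v + \<epsilon>)" using nonneg[of v] \<epsilon> by simp
    with step[of v] weak[of v] v show ?thesis by (simp add: algebra_simps)
  qed
qed

text \<open>The inverse \<open>x\<close> of \<open>1 - q - \<epsilon>\<close> starts at most at
  \<open>2 ^ Suc n\<close> and is mapped below \<open>x * (1 + \<epsilon>) / 2 + 1 / 2\<close>.
  Halving produces \<open>2 ^ Suc n / 2 ^ v\<close>, the constants sum to less than 1, and
  \<open>(1 + \<epsilon>) ^ v\<close> absorbs the error.\<close>

lemma boosting_recurrence_inverse_bound:
  fixes q :: "nat \<Rightarrow> real"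
  assumes q0: "q 0 \<le> 1 - 1 / 2 ^ n" and nonneg: "\<And>v. 0 \<le> q v"
    and \<epsilon>: "0 \<le> \<epsilon>" "\<epsilon> \<le> 1 / 2 ^ Suc n"
    and step: "\<And>v. q (Suc v) \<le> q v * (q v + \<epsilon>)"
  shows "0 < 1 - q v - \<epsilon> \<and> inverse (1 - q v - \<epsilon>) \<le> (1 + \<epsilon>) ^ v * (2 ^ Suc n / 2 ^ v + 1)"
proof (induction v)
  case 0
  have "1 / 2 ^ Suc n \<le> 1 - q 0 - \<epsilon>"
    using q0 \<epsilon> by (simp add: field_simps)
  moreover have "0 < 1 / (2::real) ^ Suc n" by simp
  ultimately have "0 < 1 - q 0 - \<epsilon>" and "inverse (1 - q 0 - \<epsilon>) \<le> inverse (1 / 2 ^ Suc n)"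
    by (linarith, intro le_imp_inverse_le)
  thus ?case by simp
next
  case (Suc v)
  define d where "d = 1 - q v - \<epsilon>"
  define e where "e = 1 - q (Suc v) - \<epsilon>"
  have d: "0 < d" "d \<le> 1 - \<epsilon>" using Suc nonneg[of v] by (auto simp: d_def)
  have "1 - q v * (q v + \<epsilon>) - \<epsilon> = d * (2 - \<epsilon> - d)"
    by (simp add: d_def algebra_simps)
  hence e: "d * (2 - \<epsilon> - d) \<le> e" using step[of v] by (simp add: e_def)
  have pos: "0 < d * (2 - \<epsilon> - d)" using d \<epsilon> by (intro mult_pos_pos) auto
  \<comment> \<open>With \<open>t = \<epsilon> + d\<close> in [0, 1], this is the chord bound
    \<open>1 / (2 - t) \<le> (1 + t) / 2\<close> for a convex function.\<close>
  have "2 \<le> (2 - \<epsilon> - d) * (1 + \<epsilon> + d)"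
  proof -
    have "0 \<le> (\<epsilon> + d) * (1 - (\<epsilon> + d))" using d \<epsilon> by (intro mult_nonneg_nonneg) auto
    thus ?thesis by (simp add: algebra_simps)
  qed
  hence le: "inverse (2 - \<epsilon> - d) \<le> (1 + \<epsilon> + d) / 2"
    using d by (simp add: field_simps)
  have "inverse e \<le> inverse (d * (2 - \<epsilon> - d))"
    using pos e by (rule le_imp_inverse_le[rotated])
  also have "\<dots> = inverse d * inverse (2 - \<epsilon> - d)" by simp
  also have "\<dots> \<le> inverse d * ((1 + \<epsilon> + d) / 2)"
    using le d by (intro mult_left_mono) auto
  also have "\<dots> = inverse d * ((1 + \<epsilon>) / 2) + 1 / 2" using d by (simp add: field_simps)
  also have "\<dots> \<le> (1 + \<epsilon>) ^ v * (2 ^ Suc n / 2 ^ v + 1) * ((1 + \<epsilon>) / 2) + (1 + \<epsilon>) ^ Suc v * (1 / 2)"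
  proof (intro add_mono mult_right_mono)
    show "inverse d \<le> (1 + \<epsilon>) ^ v * (2 ^ Suc n / 2 ^ v + 1)" using Suc by (simp add: d_def)
    show "1 / 2 \<le> (1 + \<epsilon>) ^ Suc v * (1 / 2)"
      using one_le_power[of "1 + \<epsilon>" "Suc v"] \<epsilon> by simp
  qed (use \<epsilon> in auto)
  also have "\<dots> = (1 + \<epsilon>) ^ Suc v * (2 ^ Suc n / 2 ^ Suc v + 1)"
    by (simp add: field_simps)
  finally have "inverse e \<le> (1 + \<epsilon>) ^ Suc v * (2 ^ Suc n / 2 ^ Suc v + 1)" .
  moreover have "0 < e" using pos e by linarith
  ultimately show ?case by (simp add: e_def)
qed

text \<open>Makes \<open>n * \<epsilon>\<close> at most 7/256, with equality possible at
  \<open>n = 7\<close>.\<close>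

lemma linear_le_power2:
  assumes "7 \<le> n"
  shows "256 * real n \<le> 7 * 2 ^ Suc n"
  using assms by (induction n rule: dec_induct) auto

lemma boosting_recurrence_bound:
  fixes q :: "nat \<Rightarrow> real"
  assumes n: "7 \<le> n" and q0: "q 0 \<le> 1 - 1 / 2 ^ n" and nonneg: "\<And>v. 0 \<le> q v"
    and \<epsilon>: "0 \<le> \<epsilon>" "\<epsilon> \<le> 1 / 2 ^ Suc n"
    and step: "\<And>v. q (Suc v) \<le> q v * (q v + \<epsilon>)"
  shows "q (n + 4 + k) \<le> (1 / 2 ^ 8) * (1 / 2 ^ 7) ^ k"
proof -
  have "(2::real) ^ 8 \<le> 2 ^ Suc n" using n by (intro power_increasing) auto
  hence "1 / 2 ^ Suc n \<le> 1 / (2::real) ^ 8" by (intro divide_left_mono) auto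
  with \<epsilon> have small: "\<epsilon> \<le> 1 / 2 ^ 8" by linarith
  have step': "q (Suc v) \<le> b * (b + 1 / 2 ^ 8)" if "q v \<le> b" for v b
  proof -
    have "q v * (q v + \<epsilon>) \<le> b * (b + 1 / 2 ^ 8)"
      using that small nonneg[of v] \<epsilon> by (intro mult_mono) auto
    with step[of v] show ?thesis by linarith
  qed
  have "real n * \<epsilon> \<le> real n * (1 / 2 ^ Suc n)" using \<epsilon> by (intro mult_left_mono) auto
  also have "\<dots> \<le> 7 / 256" using linear_le_power2[OF n] by (simp add: field_simps)
  finally have n\<epsilon>: "real n * \<epsilon> \<le> 7 / 256" .
  \<comment> \<open>The factor \<open>(1 + \<epsilon>) ^ n\<close> is controlled through
    \<open>(1 - \<epsilon>) ^ n\<close>: their product is at most 1, and Bernoulli bounds the latter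
    from below.\<close>
  have "\<epsilon> \<le> 1" using small by simp
  hence "1 - real n * \<epsilon> \<le> (1 - \<epsilon>) ^ n"
    using Bernoulli_inequality[of "- \<epsilon>" n] by simp
  with n\<epsilon> have bernoulli: "249 / 256 \<le> (1 - \<epsilon>) ^ n" by linarith
  define d where "d = 1 - q n - \<epsilon>"
  have d: "0 < d" "inverse d \<le> (1 + \<epsilon>) ^ n * 3"
    using boosting_recurrence_inverse_bound[where n = n and q = q and v = n, OF q0 nonneg \<epsilon> step]
    by (auto simp: d_def)
  have "(1 + \<epsilon>) ^ n * (1 - \<epsilon>) ^ n = (1 - \<epsilon> ^ 2) ^ n"
    by (simp add: power_mult_distrib[symmetric] algebra_simps power2_eq_square)
  also have "\<dots> \<le> 1" using \<epsilon> \<open>\<epsilon> \<le> 1\<close> by (intro power_le_one) (auto simp: power_le_one)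
  finally have one: "(1 + \<epsilon>) ^ n * (1 - \<epsilon>) ^ n \<le> 1" .
  have "1 \<le> (1 + \<epsilon>) ^ n * 3 * d" using d by (simp add: field_simps)
  hence "(1 - \<epsilon>) ^ n * 1 \<le> (1 - \<epsilon>) ^ n * ((1 + \<epsilon>) ^ n * 3 * d)"
    using \<open>\<epsilon> \<le> 1\<close> by (intro mult_left_mono) auto
  also have "\<dots> = ((1 + \<epsilon>) ^ n * (1 - \<epsilon>) ^ n) * (3 * d)" by simp
  also have "\<dots> \<le> 1 * (3 * d)" using one d by (intro mult_right_mono) auto
  finally have "249 / 768 \<le> d" using bernoulli by simp
  \<comment> \<open>The fractions are iterates of \<open>b * (b + 1 / 2 ^ 8)\<close>, rounded up to
    keep the arithmetic short.\<close>
  hence "q n \<le> 17 / 25" using \<epsilon> by (simp add: d_def)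
  from step'[OF this] have "q (n + 1) \<le> 47 / 100" by (simp add: power_numeral_even)
  from step'[OF this] have "q (n + 2) \<le> 9 / 40" by (simp add: power_numeral_even)
  from step'[OF this] have "q (n + 3) \<le> 13 / 250" by (simp add: power_numeral_even numeral_3_eq_3)
  from step'[OF this] have base: "q (n + 4) \<le> 1 / 2 ^ 8"
    by (simp add: power_numeral_even eval_nat_numeral)
  show ?thesis
  proof (induction k)
    case 0
    show ?case using base by simp
  next
    case (Suc k)
    have "(1 / 2 ^ 8) * (1 / 2 ^ 7) ^ k \<le> 1 / (2::real) ^ 8"
      using power_le_one[of "1 / 2 ^ 7 :: real" k] by simp
    with Suc have "q (n + 4 + k) \<le> 1 / 2 ^ 8" by linarith
    with small have "q (n + 4 + k) + \<epsilon> \<le> 1 / 2 ^ 7" by simp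
    with Suc nonneg[of "n + 4 + k"] \<epsilon>
    have "q (n + 4 + k) * (q (n + 4 + k) + \<epsilon>) \<le> (1 / 2 ^ 8 * (1 / 2 ^ 7) ^ k) * (1 / 2 ^ 7)"
      by (intro mult_mono) auto
    with step[of "n + 4 + k"] have "q (Suc (n + 4 + k)) \<le> (1 / 2 ^ 8 * (1 / 2 ^ 7) ^ k) * (1 / 2 ^ 7)"
      by (rule order_trans)
    thus ?case by simp
  qed
qed

section \<open>Runs as truth assignments\<close>

lemma lit_rv_iff_lit_true: "lit_rv X l \<omega> \<longleftrightarrow> lit_true (\<lambda>i. X i \<omega>) l"
  by (cases l) auto

lemma lit_true_cong: "a (lit_var l) = b (lit_var l) \<Longrightarrow> lit_true a l = lit_true b l"
  by (cases l) auto

lemma cnf_rv_imp_satisfiable: "cnf_rv X S \<omega> \<Longrightarrow> satisfiable S"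
  unfolding cnf_rv_def clause_rv_def satisfiable_def lit_rv_iff_lit_true by blast

text \<open>The random bits are controlled only below \<open>n\<close>, so the run may differ from
  \<open>a\<close> elsewhere; no literal of \<open>S\<close> sees the difference.\<close>

lemma cnf_rv_if_agrees:
  assumes S: "cnf_in_vars n S" and a: "\<forall>c\<in>set S. \<exists>l\<in>set c. lit_true a l"
    and agrees: "\<And>i. i < n \<Longrightarrow> X i \<omega> = a i"
  shows "cnf_rv X S \<omega>"
  unfolding cnf_rv_def clause_rv_def lit_rv_iff_lit_true
proof
  fix c assume c: "c \<in> set S"
  with a obtain l where l: "l \<in> set c" "lit_true a l" by blast
  with S c have "X (lit_var l) \<omega> = a (lit_var l)"
    by (intro agrees) (auto simp: cnf_in_vars_def)
  hence "lit_true (\<lambda>i. X i \<omega>) l" using l by (subst lit_true_cong[of _ _ a]) auto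
  with l show "\<exists>l\<in>set c. lit_true (\<lambda>i. X i \<omega>) l" by blast
qed

section \<open>Probabilities along the algorithm\<close>

context prob_space
begin

lemma binary_rv_cnf_rv:
  assumes S: "cnf_in_vars n S" and X: "\<And>i. i < n \<Longrightarrow> binary_rv (X i)"
  shows "binary_rv (cnf_rv X S)"
proof -
  have "Measurable.pred M (lit_rv X l)" if "c \<in> set S" "l \<in> set c" for c l
  proof -
    have [measurable]: "Measurable.pred M (X (lit_var l))"
      using S X that unfolding cnf_in_vars_def binary_rv_def by blast
    show ?thesis by (cases l) (use \<open>Measurable.pred M (X (lit_var l))\<close> in simp_all)
  qed
  thus ?thesis
    unfolding binary_rv_def cnf_rv_def clause_rv_def
    by (intro pred_intros_finite) auto
qed

lemma binary_rv_alb_D: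
  assumes "approx_cloning_function \<epsilon> AC" and "binary_rv (cnf_rv X S)"
  shows "binary_rv (alb_D AC X S v)"
proof (induction v)
  case 0
  show ?case using assms by simp
next
  case (Suc v)
  have [measurable]: "Measurable.pred M (alb_D AC X S v)"
    "Measurable.pred M (AC (alb_D AC X S v))"
    using Suc assms by (auto simp: binary_rv_def approx_cloning_function_def)
  show ?case unfolding binary_rv_def alb_D.simps by measurable
qed

text \<open>The next variable is 0 exactly when the current one and its clone both are, so
  independence of this pair gives a product; \<open>r\<close> is the clone's probability of
  0.\<close>

lemma prob_alb_D_Suc_False:
  assumes AC: "approx_cloning_function \<epsilon> AC" and D: "binary_rv (alb_D AC X S v)"
  obtains r where "prob {\<omega> \<in> space M. \<not> alb_D AC X S (Suc v) \<omega>}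
      = prob {\<omega> \<in> space M. \<not> alb_D AC X S v \<omega>} * r"
    and "\<bar>prob {\<omega> \<in> space M. \<not> alb_D AC X S v \<omega>} - r\<bar> \<le> \<epsilon>"
proof
  let ?D = "alb_D AC X S v"
  let ?r = "prob {\<omega> \<in> space M. \<not> AC ?D \<omega>}"
  have indep: "indep_var (count_space UNIV) ?D (count_space UNIV) (AC ?D)"
    and close: "\<bar>prob {\<omega> \<in> space M. \<not> ?D \<omega>} - ?r\<bar> \<le> \<epsilon>"
    using AC D unfolding approx_cloning_function_def by blast+
  have vimages: "(\<lambda>\<omega>. (?D \<omega>, AC ?D \<omega>)) -` ({False} \<times> {False}) \<inter> space M
      = {\<omega> \<in> space M. \<not> alb_D AC X S (Suc v) \<omega>}"
    "?D -` {False} \<inter> space M = {\<omega> \<in> space M. \<not> ?D \<omega>}"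
    "AC ?D -` {False} \<inter> space M = {\<omega> \<in> space M. \<not> AC ?D \<omega>}"
    by auto
  show "prob {\<omega> \<in> space M. \<not> alb_D AC X S (Suc v) \<omega>} = prob {\<omega> \<in> space M. \<not> ?D \<omega>} * ?r"
    using indep_varD[OF indep, of "{False}" "{False}"] unfolding vimages by simp
  show "\<bar>prob {\<omega> \<in> space M. \<not> ?D \<omega>} - ?r\<bar> \<le> \<epsilon>" by (fact close)
qed

lemma binary_rv_fair_bit:
  assumes "independent_fair_bits n X" and "i < n"
  shows "binary_rv (X i)"
  using assms unfolding independent_fair_bits_def indep_vars_def binary_rv_def by blast

lemma prob_fair_bits_agree:
  assumes bits: "independent_fair_bits n X" and n: "0 < n"
  shows "prob {\<omega> \<in> space M. \<forall>i<n. X i \<omega> = a i} = 1 / 2 ^ n"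
proof -
  have "prob (\<Inter>i\<in>{..<n}. X i -` {a i} \<inter> space M) = (\<Prod>i<n. prob (X i -` {a i} \<inter> space M))"
    using bits n unfolding independent_fair_bits_def by (intro indep_varsD_finite) auto
  \<comment> \<open>Here \<open>0 < n\<close> excludes the empty intersection, which would be
    \<open>UNIV\<close> instead of \<open>space M\<close>.\<close>
  also have "(\<Inter>i\<in>{..<n}. X i -` {a i} \<inter> space M) = {\<omega> \<in> space M. \<forall>i<n. X i \<omega> = a i}"
    using n by auto
  also have "(\<Prod>i<n. prob (X i -` {a i} \<inter> space M)) = (\<Prod>i<n. 1 / 2)"
  proof (rule prod.cong)
    fix i assume "i \<in> {..<n}"
    moreover have "X i -` {a i} \<inter> space M
        = (if a i then {\<omega> \<in> space M. X i \<omega>} else {\<omega> \<in> space M. \<not> X i \<omega>})"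
      by auto
    ultimately show "prob (X i -` {a i} \<inter> space M) = 1 / 2"
      using bits by (simp add: independent_fair_bits_def)
  qed simp
  finally show ?thesis by (simp add: power_one_over)
qed

lemma prob_not_binary_rv:
  assumes "binary_rv Y"
  shows "prob {\<omega> \<in> space M. \<not> Y \<omega>} = 1 - prob {\<omega> \<in> space M. Y \<omega>}"
  using assms unfolding binary_rv_def by (intro prob_neg) measurable

text \<open>A single satisfying assignment suffices: the bits hit it with probability
  \<open>1 / 2 ^ n\<close>.\<close>

lemma prob_cnf_rv_False_le:
  assumes bits: "independent_fair_bits n X" and n: "0 < n"
    and S: "cnf_in_vars n S" "satisfiable S"
  shows "prob {\<omega> \<in> space M. \<not> cnf_rv X S \<omega>} \<le> 1 - 1 / 2 ^ n"
proof -
  obtain a where a: "\<forall>c\<in>set S. \<exists>l\<in>set c. lit_true a l"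
    using S by (auto simp: satisfiable_def)
  have rv: "binary_rv (cnf_rv X S)"
    using binary_rv_cnf_rv[OF S(1) binary_rv_fair_bit[OF bits]] .
  have [measurable]: "Measurable.pred M (cnf_rv X S)"
    using rv by (simp add: binary_rv_def)
  have "prob {\<omega> \<in> space M. \<forall>i<n. X i \<omega> = a i} \<le> prob {\<omega> \<in> space M. cnf_rv X S \<omega>}"
    by (intro finite_measure_mono Collect_mono conj_mono imp_refl impI cnf_rv_if_agrees[OF S(1) a]) auto
  thus ?thesis
    using prob_fair_bits_agree[OF bits n, of a] prob_not_binary_rv[OF rv] by simp
qed

text \<open>A satisfiable \<open>S\<close> is handled by the first term of the maximum, an
  unsatisfiable one by the second, except that the first takes over when
  \<open>\<epsilon> = 0\<close>.\<close>

lemma alb_error_prob_less: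
  assumes n: "7 \<le> n" and S: "cnf_in_vars n S" and N: "n \<le> N"
    and \<epsilon>: "0 \<le> \<epsilon>" "\<epsilon> \<le> 1 / 2 ^ Suc n"
    and AC: "approx_cloning_function \<epsilon> AC" and bits: "independent_fair_bits n X"
  shows "alb_error_prob AC X S N < max (2 powi (- 7 * (int N - int n) + 34)) ((2 ^ N - 1) * \<epsilon>)"
proof -
  define q where "q v = prob {\<omega> \<in> space M. \<not> alb_D AC X S v \<omega>}" for v
  have q: "0 \<le> q v" "q v \<le> 1" for v by (auto simp: q_def)
  have rv: "binary_rv (alb_D AC X S v)" for v
    by (rule binary_rv_alb_D[OF AC binary_rv_cnf_rv[OF S binary_rv_fair_bit[OF bits]]])
  have step: "\<exists>r. q (Suc v) = q v * r \<and> \<bar>q v - r\<bar> \<le> \<epsilon>" for v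
    unfolding q_def by (rule prob_alb_D_Suc_False[OF AC rv]) blast
  show ?thesis
  proof (cases "satisfiable S")
    case True
    hence err: "alb_error_prob AC X S N = q N"
      by (simp add: alb_error_prob_def alb_asserts_sat_def q_def)
    have "q N < 2 powi (- 7 * (int N - int n) + 34)"
    \<comment> \<open>For \<open>N - n\<close> at most 3 the exponent is at least 13, so the bound
      exceeds 1 and is trivial.\<close>
    proof (cases "N < n + 4")
      case True
      hence "(2::real) powi 0 < 2 powi (- 7 * (int N - int n) + 34)"
        by (intro power_int_strict_increasing) auto
      with q(2)[of N] show ?thesis by simp
    next
      case False
      then obtain k where k: "N = n + 4 + k" using le_Suc_ex[of "n + 4" N] by auto
      have q0: "q 0 \<le> 1 - 1 / 2 ^ n"
        using prob_cnf_rv_False_le[OF bits _ S True] n by (simp add: q_def)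
      have up: "q (Suc v) \<le> q v * (q v + \<epsilon>)" for v
      proof -
        obtain r where "q (Suc v) = q v * r" "\<bar>q v - r\<bar> \<le> \<epsilon>" using step by blast
        thus ?thesis using q(1)[of v] by (auto intro!: mult_left_mono)
      qed
      have "q N \<le> (1 / 2 ^ 8) * (1 / 2 ^ 7) ^ k"
        unfolding k by (rule boosting_recurrence_bound[OF n q0 q(1) \<epsilon> up])
      also have "\<dots> = 2 powi (- 7 * int k - 8)"
      proof -
        have "(2::real) powi (- 7 * int k) = (1 / 2 ^ 7) ^ k"
          by (simp only: power_int_mult power_int_of_nat) (simp add: power_int_minus)
        thus ?thesis by (subst power_int_diff) simp_all
      qed
      \<comment> \<open>With \<open>N - n = k + 4\<close> the exponent on the right is
        \<open>6 - 7 * k\<close>, leaving a factor \<open>2 ^ 14\<close> to spare.\<close>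
      also have "\<dots> < 2 powi (- 7 * (int N - int n) + 34)"
        by (intro power_int_strict_increasing) (auto simp: k)
      finally show ?thesis .
    qed
    with err show ?thesis by simp
  next
    case False
    define p where "p v = 1 - q v" for v
    have err: "alb_error_prob AC X S N = p N"
      using False prob_not_binary_rv[OF rv, of N]
      by (simp add: alb_error_prob_def alb_asserts_sat_def q_def p_def)
    have "{\<omega> \<in> space M. \<not> cnf_rv X S \<omega>} = space M"
      using False by (auto dest: cnf_rv_imp_satisfiable)
    hence p0: "p 0 = 0" by (simp add: p_def q_def prob_space)
    have nonneg: "0 \<le> p v" for v using q(2)[of v] by (simp add: p_def)
    have up: "p (Suc v) \<le> 2 * p v + \<epsilon> - p v * (p v + \<epsilon>)" for v
    proof -
      obtain r where r: "q (Suc v) = q v * r" "\<bar>q v - r\<bar> \<le> \<epsilon>" using step by blast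
      \<comment> \<open>Substituting \<open>q v = 1 - p v\<close> turns this lower bound into the
        doubling recurrence; \<open>q v - \<epsilon>\<close> may be negative.\<close>
      have "q v * (q v - \<epsilon>) \<le> q v * r" using r(2) q(1)[of v] by (intro mult_left_mono) auto
      thus ?thesis by (simp add: p_def r(1) algebra_simps)
    qed
    show ?thesis
    \<comment> \<open>At \<open>\<epsilon> = 0\<close> the second term vanishes, but exact clones of
      a variable that is almost surely 0 keep the error at 0, below the positive first term.\<close>
    proof (cases "\<epsilon> = 0")
      case True
      have "p v \<le> 0" for v
      proof (induction v)
        case (Suc v)
        with nonneg[of v] have "p v = 0" by linarith
        with up[of v] True show ?case by simp
      qed (simp add: p0)
      moreover have "(0::real) < 2 powi (- 7 * (int N - int n) + 34)" by simp
      ultimately have "p N < 2 powi (- 7 * (int N - int n) + 34)" by (rule le_less_trans)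
      with err show ?thesis by simp
    next
      case False
      hence "p N < (2 ^ N - 1) * \<epsilon>"
        using \<epsilon> n N by (intro doubling_recurrence_strict_bound[OF p0 nonneg _ up]) auto
      with err show ?thesis by simp
    qed
  qed
qed

end

theorem theorem3:
  fixes M :: "'a measure"
    and X :: "nat \<Rightarrow> 'a \<Rightarrow> bool"
    and AC :: "('a \<Rightarrow> bool) \<Rightarrow> 'a \<Rightarrow> bool"
    and S :: cnf
    and n N :: nat
    and \<epsilon> :: real
  assumes "prob_space M"
    and "n \<ge> 7"
    and "cnf_in_vars n S"
    and "N \<ge> n"
    and "0 \<le> \<epsilon>"
    and "\<epsilon> \<le> 2 powi (- int n - 1)"
    and "prob_space.approx_cloning_function M \<epsilon> AC"
    and "prob_space.independent_fair_bits M n X"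
  shows "prob_space.alb_error_prob M AC X S N
           < max (2 powi (- 7 * (int N - int n) + 34)) ((2 ^ N - 1) * \<epsilon>)"
proof -
  have "(2::real) powi (- int n - 1) = 1 / 2 ^ Suc n"
    by (simp add: power_int_diff power_int_minus field_simps)
  with assms show ?thesis by (intro prob_space.alb_error_prob_less) auto
qed

end
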